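(* If $k$ is a characteristic kernel, then $\mathcal H_{\mathcal C}$ is dense in $L^2_{\mathcal C}(\mathbb P_X)$.
   Context: Setting. $(\Omega,\Sigma,\mathbb P)$ is a probability space, $\mathcal X$ a measurable space, and $k\colon\mathcal X\times\mathcal X\to\mathbb R$ is a symmetric positive definite kernel such that $k(x,\cdot)$ is Borel measurable for all $x$. $\mathcal H$ is the RKHS of $k$, assumed separable, with canonical feature map $\varphi(x)=k(x,\cdot)\in\mathcal H$. $X\colon\Omega\to\mathcal X$ is a random variable with law $\mathbb P_X$ and $\mathbb E[\|\varphi(X)\|_{\mathcal H}^2]<\infty$. Assume also that for $h\in\mathcal H$, $h=0$ $\mathbb P_X$-a.e. if and only if $h=0$; thus $\mathcal H$ is viewed as a subspace of $L^2(\mathbb P_X)$. $L^2_{\mathcal C}(\mathbb P_X)$ is the quotient of $L^2(\mathbb P_X)$ by the $\mathbb P_X$-a.e. constant functions, with inner product $\langle[f_1],[f_2]\rangle=\operatorname{Cov}[f_1(X),f_2(X)]$; $\mathcal H_{\mathcal C}=\{[h]:h\in\mathcal H\}\subseteq L^2_{\mathcal C}(\mathbb P_X)$. The kernel $k$ is characteristic if the map $\mathbb Q\mapsto\int\varphi\,d\mathbb Q\in\mathcal H$ (Bochner integral) is injective on the set of probability measures $\mathbb Q$ on $\mathcal X$ with $\int\|\varphi(x)\|_{\mathcal H}\,d\mathbb Q(x)<\infty$. *)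

theory Defs
  imports "HOL-Probability.Probability"
begin

section \<open>Kernels, reproducing kernel Hilbert spaces, feature maps\<close>

text \<open>
  As usual in the kernel literature, positive definiteness asks for \<open>\<ge> 0\<close>, not \<open>> 0\<close>.
\<close>

definition pos_def_kernel :: "'x set \<Rightarrow> ('x \<Rightarrow> 'x \<Rightarrow> real) \<Rightarrow> bool" where
  "pos_def_kernel S k \<longleftrightarrow>
     (\<forall>x\<in>S. \<forall>y\<in>S. k x y = k y x) \<and>
     (\<forall>T c. finite T \<and> T \<subseteq> S \<longrightarrow> (\<Sum>x\<in>T. \<Sum>y\<in>T. c x * c y * k x y) \<ge> 0)"

text \<open>
  The Bochner integral needs its target space to be a type.  The RKHS is therefore a complete
  real inner product space \<open>'h\<close> together with the inclusion \<open>\<iota>\<close> of \<open>'h\<close> into the functions on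
  \<open>S\<close>: \<open>\<iota> h\<close> is the element \<open>h\<close> read as a function.  The vector space operations are the
  pointwise ones, \<open>h\<close> is determined by its values on \<open>S\<close>, each function \<open>k x\<close> belongs to the
  space, and it reproduces evaluation at \<open>x\<close>.  Separability is the sort
  \<open>second_countable_topology\<close> of \<open>'h\<close>.  Values of \<open>\<iota> h\<close> outside \<open>S\<close> play no role.
\<close>

definition is_rkhs ::
  "'x set \<Rightarrow> ('x \<Rightarrow> 'x \<Rightarrow> real) \<Rightarrow> ('h :: {real_inner, banach} \<Rightarrow> 'x \<Rightarrow> real) \<Rightarrow> bool" where
  "is_rkhs S k \<iota> \<longleftrightarrow>
     (\<forall>g h. \<forall>x\<in>S. \<iota> (g + h) x = \<iota> g x + \<iota> h x) \<and>
     (\<forall>a h. \<forall>x\<in>S. \<iota> (a *\<^sub>R h) x = a * \<iota> h x) \<and>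
     (\<forall>g h. (\<forall>x\<in>S. \<iota> g x = \<iota> h x) \<longrightarrow> g = h) \<and>
     (\<forall>x\<in>S. \<exists>kx. (\<forall>y\<in>S. \<iota> kx y = k x y) \<and> (\<forall>h. \<iota> h x = inner h kx))"

definition feature_map ::
  "'x set \<Rightarrow> ('x \<Rightarrow> 'x \<Rightarrow> real) \<Rightarrow> ('h \<Rightarrow> 'x \<Rightarrow> real) \<Rightarrow> 'x \<Rightarrow> 'h" where
  "feature_map S k \<iota> x = (THE h. \<forall>y\<in>S. \<iota> h y = k x y)"

lemma feature_map:
  assumes "is_rkhs S k \<iota>" "x \<in> S"
  shows "\<forall>y\<in>S. \<iota> (feature_map S k \<iota> x) y = k x y"
    and "\<iota> h x = inner h (feature_map S k \<iota> x)"
proof -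
  obtain kx where kx: "\<forall>y\<in>S. \<iota> kx y = k x y" "\<forall>h. \<iota> h x = inner h kx"
    using assms unfolding is_rkhs_def by blast
  have "feature_map S k \<iota> x = kx"
    unfolding feature_map_def
  proof (rule the_equality)
    fix h assume "\<forall>y\<in>S. \<iota> h y = k x y"
    then have "\<forall>y\<in>S. \<iota> h y = \<iota> kx y" using kx(1) by simp
    then show "h = kx" using assms(1) unfolding is_rkhs_def by blast
  qed (use kx in simp)
  then show "\<forall>y\<in>S. \<iota> (feature_map S k \<iota> x) y = k x y"
    and "\<iota> h x = inner h (feature_map S k \<iota> x)"
    using kx by auto
qed

definition characteristic_kernel ::
  "'x measure \<Rightarrow> ('x \<Rightarrow> 'x \<Rightarrow> real) \<Rightarrow>
   ('h :: {real_inner, banach, second_countable_topology} \<Rightarrow> 'x \<Rightarrow> real) \<Rightarrow> bool" where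
  "characteristic_kernel N k \<iota> \<longleftrightarrow>
     inj_on (\<lambda>Q. integral\<^sup>L Q (feature_map (space N) k \<iota>))
       {Q. prob_space Q \<and> sets Q = sets N \<and>
           integrable Q (\<lambda>x. norm (feature_map (space N) k \<iota> x))}"


section \<open>Square integrable functions modulo a.e. constants\<close>

definition L2 :: "'x measure \<Rightarrow> ('x \<Rightarrow> real) set" where
  "L2 P = {f \<in> borel_measurable P. integrable P (\<lambda>x. (f x)\<^sup>2)}"

definition ae_const_rel :: "'x measure \<Rightarrow> (('x \<Rightarrow> real) \<times> ('x \<Rightarrow> real)) set" where
  "ae_const_rel P = {(f, g). f \<in> L2 P \<and> g \<in> L2 P \<and> (\<exists>c. AE x in P. f x - g x = c)}"

definition L2C :: "'x measure \<Rightarrow> ('x \<Rightarrow> real) set set" where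
  "L2C P = L2 P // ae_const_rel P"

definition L2C_class :: "'x measure \<Rightarrow> ('x \<Rightarrow> real) \<Rightarrow> ('x \<Rightarrow> real) set" where
  "L2C_class P f = ae_const_rel P `` {f}"

definition L2C_rep :: "('x \<Rightarrow> real) set \<Rightarrow> 'x \<Rightarrow> real" where
  "L2C_rep F = (SOME f. f \<in> F)"

definition L2C_diff ::
  "'x measure \<Rightarrow> ('x \<Rightarrow> real) set \<Rightarrow> ('x \<Rightarrow> real) set \<Rightarrow> ('x \<Rightarrow> real) set" where
  "L2C_diff P F G = L2C_class P (\<lambda>x. L2C_rep F x - L2C_rep G x)"

definition covariance :: "'w measure \<Rightarrow> ('w \<Rightarrow> real) \<Rightarrow> ('w \<Rightarrow> real) \<Rightarrow> real" where
  "covariance M U V =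
     (LINT w|M. (U w - (LINT v|M. U v)) * (V w - (LINT v|M. V v)))"

text \<open>
  Below, \<open>X\<close> is a random variable on \<open>M\<close> with values in \<open>N\<close>, and \<open>P\<close> above is its law
  \<open>distr M N X\<close>.
\<close>

definition L2C_inner ::
  "'w measure \<Rightarrow> ('w \<Rightarrow> 'x) \<Rightarrow> ('x \<Rightarrow> real) set \<Rightarrow> ('x \<Rightarrow> real) set \<Rightarrow> real" where
  "L2C_inner M X F G = covariance M (\<lambda>w. L2C_rep F (X w)) (\<lambda>w. L2C_rep G (X w))"

definition L2C_dist ::
  "'w measure \<Rightarrow> 'x measure \<Rightarrow> ('w \<Rightarrow> 'x) \<Rightarrow> ('x \<Rightarrow> real) set \<Rightarrow> ('x \<Rightarrow> real) set \<Rightarrow> real" where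
  "L2C_dist M N X F G =
     (let D = L2C_diff (distr M N X) F G in sqrt (L2C_inner M X D D))"

definition L2C_topology ::
  "'w measure \<Rightarrow> 'x measure \<Rightarrow> ('w \<Rightarrow> 'x) \<Rightarrow> ('x \<Rightarrow> real) set topology" where
  "L2C_topology M N X = Metric_space.mtopology (L2C (distr M N X)) (L2C_dist M N X)"

definition HC :: "'x measure \<Rightarrow> ('h \<Rightarrow> 'x \<Rightarrow> real) \<Rightarrow> ('x \<Rightarrow> real) set set" where
  "HC P \<iota> = {L2C_class P (\<iota> h) | h. True}"


section \<open>The quotient is a metric space\<close>

text \<open>
  The inner product does not depend on the representatives picked by \<^const>\<open>L2C_rep\<close>, and
  \<^const>\<open>L2C_dist\<close> is a metric, so that \<^const>\<open>L2C_topology\<close> is the norm topology.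
\<close>

lemma L2_lincomb:
  assumes "f \<in> L2 P" "g \<in> L2 P"
  shows "(\<lambda>x. a * f x + b * g x) \<in> L2 P"
proof -
  have m [measurable]: "f \<in> borel_measurable P" "g \<in> borel_measurable P"
    and i: "integrable P (\<lambda>x. (f x)\<^sup>2)" "integrable P (\<lambda>x. (g x)\<^sup>2)"
    using assms by (auto simp: L2_def)
  have "integrable P (\<lambda>x. (a * f x + b * g x)\<^sup>2)"
  proof (rule Bochner_Integration.integrable_bound)
    show "integrable P (\<lambda>x. 2 * (a\<^sup>2 * (f x)\<^sup>2) + 2 * (b\<^sup>2 * (g x)\<^sup>2))"
      using i by auto
    have "(a * u + b * v)\<^sup>2 \<le> 2 * (a\<^sup>2 * u\<^sup>2) + 2 * (b\<^sup>2 * v\<^sup>2)" for u v :: real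
      using zero_le_power2[of "a * u - b * v"]
      by (simp add: power2_eq_square algebra_simps)
    then show "AE x in P. norm ((a * f x + b * g x)\<^sup>2)
        \<le> norm (2 * (a\<^sup>2 * (f x)\<^sup>2) + 2 * (b\<^sup>2 * (g x)\<^sup>2))"
      by (intro AE_I2) (auto intro: order_trans[OF _ abs_ge_self])
  qed measurable
  then show ?thesis by (auto simp: L2_def)
qed

lemma L2_diff: "f \<in> L2 P \<Longrightarrow> g \<in> L2 P \<Longrightarrow> (\<lambda>x. f x - g x) \<in> L2 P"
  using L2_lincomb[of f P g 1 "-1"] by simp

lemma equiv_ae_const_rel: "equiv (L2 P) (ae_const_rel P)"
proof (rule equivI)
  show "ae_const_rel P \<subseteq> L2 P \<times> L2 P" by (auto simp: ae_const_rel_def)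
  show "refl_on (L2 P) (ae_const_rel P)"
    by (auto simp: refl_on_def ae_const_rel_def intro!: exI[of _ 0])
  show "sym (ae_const_rel P)"
  proof (rule symI)
    fix f g assume "(f, g) \<in> ae_const_rel P"
    then obtain c where "f \<in> L2 P" "g \<in> L2 P" "AE x in P. f x - g x = c"
      by (auto simp: ae_const_rel_def)
    moreover from this(3) have "AE x in P. g x - f x = - c" by eventually_elim auto
    ultimately show "(g, f) \<in> ae_const_rel P" by (auto simp: ae_const_rel_def)
  qed
  show "trans (ae_const_rel P)"
  proof (rule transI)
    fix f g h assume "(f, g) \<in> ae_const_rel P" "(g, h) \<in> ae_const_rel P"
    then obtain c d where fh: "f \<in> L2 P" "h \<in> L2 P"
      and *: "AE x in P. f x - g x = c" "AE x in P. g x - h x = d"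
      by (auto simp: ae_const_rel_def)
    from * have "AE x in P. f x - h x = c + d" by eventually_elim auto
    then show "(f, h) \<in> ae_const_rel P" using fh by (auto simp: ae_const_rel_def)
  qed
qed

lemma L2C_class_in: "f \<in> L2 P \<Longrightarrow> L2C_class P f \<in> L2C P"
  unfolding L2C_class_def L2C_def by (rule quotientI)

lemma L2C_class_eq_iff:
  assumes "f \<in> L2 P" "g \<in> L2 P"
  shows "L2C_class P f = L2C_class P g \<longleftrightarrow> (\<exists>c. AE x in P. f x - g x = c)"
  using eq_equiv_class_iff[OF equiv_ae_const_rel assms] assms
  by (auto simp: L2C_class_def ae_const_rel_def)

lemma L2C_rep:
  assumes "F \<in> L2C P"
  shows "L2C_rep F \<in> L2 P" "L2C_class P (L2C_rep F) = F"
proof -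
  from assms obtain f where f: "f \<in> L2 P" "F = ae_const_rel P `` {f}"
    unfolding L2C_def by (rule quotientE)
  then have "f \<in> F" using equiv_class_self[OF equiv_ae_const_rel] by simp
  then have "L2C_rep F \<in> F" unfolding L2C_rep_def by (rule someI[of "\<lambda>f. f \<in> F"])
  then have r: "(f, L2C_rep F) \<in> ae_const_rel P" using f by simp
  then show "L2C_rep F \<in> L2 P" by (simp add: ae_const_rel_def)
  show "L2C_class P (L2C_rep F) = F"
    using equiv_class_eq[OF equiv_ae_const_rel r] f by (simp add: L2C_class_def)
qed

context
  fixes M :: "'w measure" and N :: "'x measure" and X :: "'w \<Rightarrow> 'x"
  assumes M: "prob_space M" and X [measurable]: "X \<in> measurable M N"
begin

interpretation prob_space M by (rule M)

private abbreviation (input) "P \<equiv> distr M N X"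
private abbreviation (input) "Cov f g \<equiv> covariance M (\<lambda>w. f (X w)) (\<lambda>w. g (X w))"

lemma L2_law:
  assumes "f \<in> L2 P"
  shows "(\<lambda>w. f (X w)) \<in> borel_measurable M" "integrable M (\<lambda>w. (f (X w))\<^sup>2)"
    and "integrable M (\<lambda>w. f (X w))"
proof -
  have f [measurable]: "f \<in> borel_measurable N" using assms by (auto simp: L2_def)
  show 1: "(\<lambda>w. f (X w)) \<in> borel_measurable M" by measurable
  show 2: "integrable M (\<lambda>w. (f (X w))\<^sup>2)"
    using assms by (auto simp: L2_def integrable_distr_eq)
  show "integrable M (\<lambda>w. f (X w))"
    by (rule square_integrable_imp_integrable[OF 1 2])
qed

lemma L2_mult_integrable:
  assumes "f \<in> L2 P" "g \<in> L2 P"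
  shows "integrable M (\<lambda>w. f (X w) * g (X w))"
proof (rule Bochner_Integration.integrable_bound)
  show "integrable M (\<lambda>w. (f (X w))\<^sup>2 + (g (X w))\<^sup>2)"
    using L2_law assms by auto
  show "(\<lambda>w. f (X w) * g (X w)) \<in> borel_measurable M"
    using L2_law(1)[OF assms(1)] L2_law(1)[OF assms(2)] by measurable
  have "\<bar>u * v\<bar> \<le> u\<^sup>2 + v\<^sup>2" for u v :: real
  proof -
    have "0 \<le> \<bar>u\<bar> * \<bar>v\<bar>" by simp
    moreover have "2 * \<bar>u\<bar> * \<bar>v\<bar> \<le> u\<^sup>2 + v\<^sup>2"
      using sum_squares_bound[of "\<bar>u\<bar>" "\<bar>v\<bar>"] by simp
    ultimately show ?thesis unfolding abs_mult by linarith
  qed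
  then show "AE w in M. norm (f (X w) * g (X w)) \<le> norm ((f (X w))\<^sup>2 + (g (X w))\<^sup>2)"
    by (intro AE_I2) (auto intro: order_trans[OF _ abs_ge_self])
qed

lemma Cov_eq:
  assumes "f \<in> L2 P" "g \<in> L2 P"
  shows "Cov f g = expectation (\<lambda>w. f (X w) * g (X w))
           - expectation (\<lambda>w. f (X w)) * expectation (\<lambda>w. g (X w))"
proof -
  note i = L2_law(3)[OF assms(1)] L2_law(3)[OF assms(2)] L2_mult_integrable[OF assms]
  let ?a = "expectation (\<lambda>w. f (X w))" and ?b = "expectation (\<lambda>w. g (X w))"
  have "Cov f g = expectation (\<lambda>w. f (X w) * g (X w) - ?b * f (X w) - ?a * g (X w) + ?a * ?b)"
    unfolding covariance_def by (rule Bochner_Integration.integral_cong) (auto simp: algebra_simps)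
  also have "\<dots> = expectation (\<lambda>w. f (X w) * g (X w)) - ?b * ?a - ?a * ?b + ?a * ?b"
    using i by (simp add: prob_space)
  finally show ?thesis by (simp add: algebra_simps)
qed

lemma Cov_lincomb_left:
  assumes "f \<in> L2 P" "g \<in> L2 P" "h \<in> L2 P"
  shows "Cov (\<lambda>x. a * f x + b * g x) h = a * Cov f h + b * Cov g h"
proof -
  note i = L2_law(3)[OF assms(1)] L2_law(3)[OF assms(2)]
    L2_mult_integrable[OF assms(1,3)] L2_mult_integrable[OF assms(2,3)]
  show ?thesis
    using i Cov_eq[OF L2_lincomb[OF assms(1,2)] assms(3), of a b]
    by (simp add: Cov_eq assms distrib_right mult.assoc) (simp add: algebra_simps)
qed

lemma Cov_commute: "Cov f g = Cov g f"
  by (simp add: covariance_def mult.commute)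

lemma Cov_nonneg: "0 \<le> Cov f f"
  by (auto simp: covariance_def intro!: Bochner_Integration.integral_nonneg)

lemma Cov_lincomb_self:
  assumes "f \<in> L2 P" "g \<in> L2 P"
  shows "Cov (\<lambda>x. a * f x + b * g x) (\<lambda>x. a * f x + b * g x)
           = a\<^sup>2 * Cov f f + 2 * (a * b) * Cov f g + b\<^sup>2 * Cov g g"
proof -
  let ?l = "\<lambda>x. a * f x + b * g x"
  have l: "?l \<in> L2 P" by (rule L2_lincomb[OF assms])
  have "Cov ?l ?l = a * Cov ?l f + b * Cov ?l g"
    using Cov_lincomb_left[OF assms l, of a b] by (simp add: Cov_commute[of _ ?l])
  then show ?thesis
    using Cov_lincomb_left[OF assms assms(1), of a b] Cov_lincomb_left[OF assms assms(2), of a b]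
    by (simp add: Cov_commute[of g f] power2_eq_square algebra_simps)
qed

lemma Cov_Cauchy_Schwarz:
  assumes "f \<in> L2 P" "g \<in> L2 P"
  shows "\<bar>Cov f g\<bar> \<le> sqrt (Cov f f) * sqrt (Cov g g)"
proof -
  let ?A = "Cov f f" and ?B = "Cov f g" and ?C = "Cov g g"
  have q: "0 \<le> a\<^sup>2 * ?A + 2 * (a * b) * ?B + b\<^sup>2 * ?C" for a b
    using Cov_nonneg[of "\<lambda>x. a * f x + b * g x"] unfolding Cov_lincomb_self[OF assms] .
  have "?B\<^sup>2 \<le> ?A * ?C"
  proof (cases "?C = 0")
    case True
    then have *: "0 \<le> ?A + 2 * b * ?B" for b using q[of 1 b] by simp
    have "?B = 0"
    proof (rule ccontr)
      assume "?B \<noteq> 0"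
      then show False using *[of "- (?A + 1) / (2 * ?B)"] by (simp add: field_simps)
    qed
    then show ?thesis using True by simp
  next
    case False
    then have "?C > 0" using Cov_nonneg[of g] by simp
    moreover have "0 \<le> ?C * (?A * ?C - ?B\<^sup>2)"
      using q[of ?C "- ?B"] by (simp add: power2_eq_square algebra_simps)
    ultimately show ?thesis by (simp add: zero_le_mult_iff)
  qed
  then have "sqrt (?B\<^sup>2) \<le> sqrt (?A * ?C)" by (rule real_sqrt_le_mono)
  then show ?thesis by (simp add: real_sqrt_mult)
qed

lemma Cov_triangle:
  assumes "f \<in> L2 P" "g \<in> L2 P"
  shows "sqrt (Cov (\<lambda>x. f x + g x) (\<lambda>x. f x + g x)) \<le> sqrt (Cov f f) + sqrt (Cov g g)"
proof (rule real_le_lsqrt)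
  have "Cov (\<lambda>x. f x + g x) (\<lambda>x. f x + g x) = Cov f f + 2 * Cov f g + Cov g g"
    using Cov_lincomb_self[OF assms, of 1 1] by simp
  also have "\<dots> \<le> (sqrt (Cov f f) + sqrt (Cov g g))\<^sup>2"
    using Cov_Cauchy_Schwarz[OF assms] Cov_nonneg[of f] Cov_nonneg[of g]
    by (simp add: power2_sum)
  finally show "Cov (\<lambda>x. f x + g x) (\<lambda>x. f x + g x) \<le> (sqrt (Cov f f) + sqrt (Cov g g))\<^sup>2" .
qed (use Cov_nonneg in auto)

lemma Cov_cong_ae_const:
  assumes "f \<in> L2 P" "g \<in> L2 P" "AE x in P. f x - g x = c" and "h \<in> L2 P"
  shows "Cov f h = Cov g h"
proof -
  have [measurable]: "f \<in> borel_measurable N" "g \<in> borel_measurable N" "h \<in> borel_measurable N"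
    using assms by (auto simp: L2_def)
  have ae: "AE w in M. f (X w) - g (X w) = c"
    using assms(3) by (subst (asm) AE_distr_iff) auto
  have e: "expectation (\<lambda>w. f (X w)) = expectation (\<lambda>w. g (X w)) + c"
  proof -
    have "expectation (\<lambda>w. f (X w)) = expectation (\<lambda>w. g (X w) + c)"
      using ae by (intro integral_cong_AE) auto
    then show ?thesis using L2_law(3)[OF assms(2)] by (simp add: prob_space)
  qed
  have "AE w in M. f (X w) - expectation (\<lambda>w. f (X w)) = g (X w) - expectation (\<lambda>w. g (X w))"
    using ae by eventually_elim (simp add: e)
  then show ?thesis
    unfolding covariance_def by (intro integral_cong_AE) auto
qed

lemma L2C_inner_class:
  assumes f: "f \<in> L2 P" and g: "g \<in> L2 P"
  shows "L2C_inner M X (L2C_class P f) (L2C_class P g) = Cov f g"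
proof -
  let ?f = "L2C_rep (L2C_class P f)" and ?g = "L2C_rep (L2C_class P g)"
  have f': "?f \<in> L2 P" "\<exists>c. AE x in P. ?f x - f x = c"
    using L2C_rep[OF L2C_class_in[OF f]] L2C_class_eq_iff[of ?f P f] f by auto
  have g': "?g \<in> L2 P" "\<exists>c. AE x in P. ?g x - g x = c"
    using L2C_rep[OF L2C_class_in[OF g]] L2C_class_eq_iff[of ?g P g] g by auto
  have "L2C_inner M X (L2C_class P f) (L2C_class P g) = Cov ?f ?g"
    by (simp add: L2C_inner_def)
  also have "\<dots> = Cov f ?g" using Cov_cong_ae_const[OF f'(1) f _ g'(1)] f'(2) by blast
  also have "\<dots> = Cov ?g f" by (rule Cov_commute)
  also have "\<dots> = Cov g f" using Cov_cong_ae_const[OF g'(1) g _ f] g'(2) by blast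
  finally show ?thesis by (simp add: Cov_commute)
qed

lemma L2C_diff_class:
  assumes f: "f \<in> L2 P" and g: "g \<in> L2 P"
  shows "L2C_diff P (L2C_class P f) (L2C_class P g) = L2C_class P (\<lambda>x. f x - g x)"
proof -
  let ?f = "L2C_rep (L2C_class P f)" and ?g = "L2C_rep (L2C_class P g)"
  obtain c where f': "?f \<in> L2 P" "AE x in P. ?f x - f x = c"
    using L2C_rep[OF L2C_class_in[OF f]] L2C_class_eq_iff[of ?f P f] f by auto
  obtain d where g': "?g \<in> L2 P" "AE x in P. ?g x - g x = d"
    using L2C_rep[OF L2C_class_in[OF g]] L2C_class_eq_iff[of ?g P g] g by auto
  have "AE x in P. (?f x - ?g x) - (f x - g x) = c - d"
    using f'(2) g'(2) by eventually_elim auto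
  then show ?thesis
    unfolding L2C_diff_def using f g f' g' by (subst L2C_class_eq_iff) (auto intro: L2_diff)
qed

lemma L2C_dist_class:
  assumes f: "f \<in> L2 P" and g: "g \<in> L2 P"
  shows "L2C_dist M N X (L2C_class P f) (L2C_class P g)
           = sqrt (Cov (\<lambda>x. f x - g x) (\<lambda>x. f x - g x))"
  using assms by (simp add: L2C_dist_def L2C_diff_class L2C_inner_class L2_diff)

lemma Cov_self_eq_0:
  assumes "f \<in> L2 P" "Cov f f = 0"
  shows "\<exists>c. AE x in P. f x = c"
proof -
  have [measurable]: "f \<in> borel_measurable N" using assms by (auto simp: L2_def)
  let ?a = "expectation (\<lambda>w. f (X w))"
  have "(\<lambda>x. 1 * f x + (- ?a) * 1) \<in> L2 P"
    by (rule L2_lincomb[OF assms(1)])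
      (use prob_space_distr[OF X] in \<open>simp add: L2_def prob_space_def finite_measure.integrable_const\<close>)
  then have "integrable M (\<lambda>w. (f (X w) - ?a)\<^sup>2)" using L2_law(2) by fastforce
  moreover have "expectation (\<lambda>w. (f (X w) - ?a)\<^sup>2) = 0"
    using assms(2) by (simp add: covariance_def power2_eq_square)
  ultimately have "AE w in M. (f (X w) - ?a)\<^sup>2 = 0"
    by (subst (asm) integral_nonneg_eq_0_iff_AE) auto
  then have "AE w in M. f (X w) = ?a" by eventually_elim simp
  then have "AE x in P. f x = ?a" by (subst AE_distr_iff) auto
  then show ?thesis by blast
qed

lemma Metric_space_L2C: "Metric_space (L2C P) (L2C_dist M N X)"
proof
  show "0 \<le> L2C_dist M N X F G" for F G
    by (auto simp: L2C_dist_def Let_def L2C_inner_def intro: Cov_nonneg)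
next
  fix F G :: "('x \<Rightarrow> real) set"
  let ?d = "\<lambda>x. L2C_rep F x - L2C_rep G x" and ?e = "\<lambda>x. L2C_rep G x - L2C_rep F x"
  show "L2C_dist M N X F G = L2C_dist M N X G F"
  proof (cases "?d \<in> L2 P")
    case True
    then have e: "?e \<in> L2 P" using L2_lincomb[OF True True, of "-1" 0] by simp
    have "Cov ?e ?e = Cov ?d ?d" using Cov_lincomb_self[OF True True, of "-1" 0] by simp
    then show ?thesis
      using True e by (simp add: L2C_dist_def L2C_diff_def L2C_inner_class)
  next
    case False
    then have e: "?e \<notin> L2 P" using L2_lincomb[of ?e P ?e "-1" 0] by auto
    have "L2C_class P f = {}" if "f \<notin> L2 P" for f
      using that by (auto simp: L2C_class_def ae_const_rel_def)
    then show ?thesis using False e by (simp add: L2C_dist_def L2C_diff_def)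
  qed
next
  fix F G assume FG: "F \<in> L2C P" "G \<in> L2C P"
  let ?f = "L2C_rep F" and ?g = "L2C_rep G"
  note r = L2C_rep[OF FG(1)] L2C_rep[OF FG(2)]
  have d: "L2C_dist M N X F G = sqrt (Cov (\<lambda>x. ?f x - ?g x) (\<lambda>x. ?f x - ?g x))"
    using L2C_dist_class[OF r(1,3)] r by simp
  show "L2C_dist M N X F G = 0 \<longleftrightarrow> F = G"
  proof
    assume "L2C_dist M N X F G = 0"
    then have "\<exists>c. AE x in P. ?f x - ?g x = c"
      using Cov_self_eq_0[OF L2_diff[OF r(1,3)]] d by simp
    then show "F = G" using L2C_class_eq_iff[OF r(1,3)] r by simp
  next
    assume "F = G"
    then show "L2C_dist M N X F G = 0" using d by (simp add: covariance_def)
  qed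
next
  fix F G H assume FGH: "F \<in> L2C P" "G \<in> L2C P" "H \<in> L2C P"
  note r = L2C_rep[OF FGH(1)] L2C_rep[OF FGH(2)] L2C_rep[OF FGH(3)]
  show "L2C_dist M N X F H \<le> L2C_dist M N X F G + L2C_dist M N X G H"
    using Cov_triangle[OF L2_diff[OF r(1,3)] L2_diff[OF r(3,5)]]
      L2C_dist_class[OF r(1,3)] L2C_dist_class[OF r(3,5)] L2C_dist_class[OF r(1,5)] r
    by simp
qed

end

end

theory Submission
  imports Defs
begin

text \<open>
  Density of \<open>\<H>\<^sub>\<C>\<close> in \<open>L\<^sup>2\<^sub>\<C>(P)\<close>, where \<open>P\<close> is the law of \<open>X\<close>, amounts to density of
  \<open>V = \<H> + \<real>\<close> in \<open>L\<^sup>2(P)\<close>, because the variance of a function is at most its mean squared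
  distance to any constant.  So let \<open>r\<close> be the residual of some \<open>f \<in> L\<^sup>2(P)\<close> after orthogonal
  projection onto the closure of \<open>V\<close> (\<open>L2_projection\<close>); it has to be shown that \<open>r = 0\<close>.

  Orthogonality to the constants gives \<open>\<integral> r dP = 0\<close>, so \<open>r\<^sup>+\<close> and \<open>r\<^sup>-\<close> have a common integral \<open>c\<close>.
  If \<open>c > 0\<close>, then \<open>r\<^sup>+ / c\<close> and \<open>r\<^sup>- / c\<close> are densities of probability measures \<open>Q\<^sub>1\<close> and \<open>Q\<^sub>2\<close>, and
  both integrate \<open>\<parallel>\<phi>\<parallel>\<close> because \<open>r\<close> and \<open>\<parallel>\<phi>\<parallel>\<close> are square integrable.  Orthogonality to \<open>\<H>\<close> says
  \<open>\<langle>h, \<integral> r \<phi> dP\<rangle> = \<integral> r h dP = 0\<close> for every \<open>h \<in> \<H>\<close>, so \<open>Q\<^sub>1\<close> and \<open>Q\<^sub>2\<close> have the same mean embedding.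
  A characteristic kernel forces \<open>Q\<^sub>1 = Q\<^sub>2\<close>, hence \<open>r\<^sup>+ = r\<^sup>-\<close> and \<open>r = 0\<close> almost everywhere
  (\<open>characteristic_kernel_annihilator\<close>).

  Two facts support this.  The projection requires completeness of \<open>L\<^sup>2\<close>
  (\<open>L2_geometrically_Cauchy_convergent\<close>), and the Bochner integrals require the feature map to
  be measurable, which follows from separability of \<open>\<H>\<close> and measurability of the sections
  \<open>k(x, \<cdot>)\<close> (\<open>feature_map_measurable\<close>).
\<close>


section \<open>Orthogonal projection in the space of square integrable functions\<close>

lemma L2_product_integrable:
  assumes "f \<in> L2 P" "g \<in> L2 P"
  shows "integrable P (\<lambda>x. f x * g x)"
proof -
  have "(\<lambda>x. 1 * f x + 1 * g x) \<in> L2 P"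
    by (rule L2_lincomb[OF assms])
  then have "integrable P (\<lambda>x. ((f x + g x)\<^sup>2 - (f x)\<^sup>2 - (g x)\<^sup>2) / 2)"
    using assms by (auto simp: L2_def)
  then show ?thesis
    by (simp add: power2_sum)
qed

lemma L2_lincomb_square_integral:
  assumes "f \<in> L2 P" "g \<in> L2 P"
  shows "(\<integral>x. (a * f x + b * g x)\<^sup>2 \<partial>P)
    = a\<^sup>2 * (\<integral>x. (f x)\<^sup>2 \<partial>P) + 2 * a * b * (\<integral>x. f x * g x \<partial>P) + b\<^sup>2 * (\<integral>x. (g x)\<^sup>2 \<partial>P)"
proof -
  have i: "integrable P (\<lambda>x. (f x)\<^sup>2)" "integrable P (\<lambda>x. (g x)\<^sup>2)"
      "integrable P (\<lambda>x. f x * g x)"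
    using assms L2_product_integrable[OF assms] by (auto simp: L2_def)
  have "(\<integral>x. (a * f x + b * g x)\<^sup>2 \<partial>P)
      = (\<integral>x. a\<^sup>2 * (f x)\<^sup>2 + 2 * a * b * (f x * g x) + b\<^sup>2 * (g x)\<^sup>2 \<partial>P)"
    by (rule Bochner_Integration.integral_cong) (auto simp: power2_eq_square algebra_simps)
  then show ?thesis
    using i by simp
qed

lemma nonneg_quadratic_discriminant:
  fixes a b c :: real
  assumes q: "\<And>t. 0 \<le> a + 2 * t * b + t\<^sup>2 * c" and c: "0 \<le> c"
  shows "b\<^sup>2 \<le> a * c"
proof (cases "c = 0")
  case True
  have "b = 0"
  proof (rule ccontr)
    assume "b \<noteq> 0"
    then show False
      using q[of "- (a + 1) / (2 * b)"] True by (simp add: field_simps)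
  qed
  then show ?thesis
    using True by simp
next
  case False
  then have "0 < c"
    using c by simp
  moreover have "0 \<le> (a * c - b\<^sup>2) / c"
    using q[of "- b / c"] False by (simp add: power2_eq_square field_simps)
  ultimately show ?thesis
    by (simp add: zero_le_divide_iff)
qed

lemma L2_Cauchy_Schwarz:
  assumes "f \<in> L2 P" "g \<in> L2 P"
  shows "(\<integral>x. f x * g x \<partial>P)\<^sup>2 \<le> (\<integral>x. (f x)\<^sup>2 \<partial>P) * (\<integral>x. (g x)\<^sup>2 \<partial>P)"
proof (rule nonneg_quadratic_discriminant)
  fix t :: real
  have "0 \<le> (\<integral>x. (1 * f x + t * g x)\<^sup>2 \<partial>P)"
    by (rule Bochner_Integration.integral_nonneg) simp
  then show "0 \<le> (\<integral>x. (f x)\<^sup>2 \<partial>P) + 2 * t * (\<integral>x. f x * g x \<partial>P) + t\<^sup>2 * (\<integral>x. (g x)\<^sup>2 \<partial>P)"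
    unfolding L2_lincomb_square_integral[OF assms] by simp
qed simp

text \<open>
  Completeness of \<open>L\<^sup>2\<close>, for sequences so fast that no subsequence has to be chosen.  Weighting the
  squared increments by \<open>4 ^ n\<close> keeps their integrals summable, so at almost every point
  the \<open>n\<close>-th increment is \<open>O((1/2) ^ n)\<close> and the sequence converges; Fatou's lemma carries
  the \<open>L\<^sup>2\<close> bounds over to the pointwise limit.
\<close>

lemma L2_geometrically_Cauchy_convergent:
  assumes v: "\<And>n. v n \<in> L2 P"
    and C: "\<And>m n. n \<le> m \<Longrightarrow> (\<integral>x. (v n x - v m x)\<^sup>2 \<partial>P) \<le> C * (1/8) ^ n"
  obtains p where "p \<in> L2 P" "\<And>n. (\<integral>x. (v n x - p x)\<^sup>2 \<partial>P) \<le> C * (1/8) ^ n"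
proof -
  have [measurable]: "v n \<in> borel_measurable P" for n
    using v[of n] by (simp add: L2_def)
  have int: "integrable P (\<lambda>x. (v n x - v m x)\<^sup>2)" for m n
    using L2_diff[OF v v] by (simp add: L2_def)
  have C0: "0 \<le> C"
    using C[of 0 0] by simp
  \<comment> \<open>\<open>4 ^ n\<close> lies strictly between \<open>1\<close> and the rate \<open>8 ^ n\<close> of the hypothesis\<close>
  let ?w = "\<lambda>n x. 4 ^ n * (v n x - v (Suc n) x)\<^sup>2"
  have "AE x in P. (\<Sum>n. ennreal (?w n x)) \<noteq> \<infinity>"
  proof (rule nn_integral_PInf_AE)
    have "(\<integral>\<^sup>+x. (\<Sum>n. ennreal (?w n x)) \<partial>P) = (\<Sum>n. \<integral>\<^sup>+x. ennreal (?w n x) \<partial>P)"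
      by (rule nn_integral_suminf) measurable
    also have "\<dots> \<le> (\<Sum>n. ennreal (C * (1/2) ^ n))"
    proof (rule suminf_le)
      fix n
      have "(\<integral>\<^sup>+x. ennreal (?w n x) \<partial>P) = ennreal (\<integral>x. ?w n x \<partial>P)"
        using int by (intro nn_integral_eq_integral) auto
      also have "\<dots> \<le> ennreal (4 ^ n * (C * (1/8) ^ n))"
        using C[of n "Suc n"] by (intro ennreal_leI) auto
      also have "4 ^ n * (C * (1/8) ^ n) = C * (4 * (1/8)) ^ n"
        unfolding power_mult_distrib by simp
      finally show "(\<integral>\<^sup>+x. ennreal (?w n x) \<partial>P) \<le> ennreal (C * (1/2) ^ n)"
        by simp
    qed auto
    also have "\<dots> = ennreal (\<Sum>n. C * (1/2) ^ n)"
      using C0 by (intro suminf_ennreal2) (auto intro!: summable_mult summable_geometric)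
    also have "\<dots> < \<infinity>"
      by simp
    finally show "(\<integral>\<^sup>+x. (\<Sum>n. ennreal (?w n x)) \<partial>P) \<noteq> \<infinity>"
      by simp
  qed measurable
  then have conv: "AE x in P. (\<lambda>n. v n x) \<longlonglongrightarrow> lim (\<lambda>n. v n x)"
  proof eventually_elim
    fix x assume "(\<Sum>n. ennreal (?w n x)) \<noteq> \<infinity>"
    then have "summable (\<lambda>n. ?w n x)"
      by (intro summable_suminf_not_top) auto
    then have "Bseq (\<lambda>n. ?w n x)"
      by (intro convergent_imp_Bseq convergentI[of _ 0] summable_LIMSEQ_zero)
    then obtain K where K: "0 < K" "\<And>n. ?w n x \<le> K"
      by (auto simp: Bseq_def)
    have "summable (\<lambda>n. v (Suc n) x - v n x)"
    proof (rule summable_comparison_test')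
      show "summable (\<lambda>n. sqrt K * (1/2) ^ n)"
        by (intro summable_mult summable_geometric) simp
      fix n
      have "(2 ^ n * \<bar>v n x - v (Suc n) x\<bar>)\<^sup>2 = (2 ^ n)\<^sup>2 * (v n x - v (Suc n) x)\<^sup>2"
        by (simp add: power_mult_distrib)
      also have "\<dots> = ?w n x"
        by (simp flip: power_mult power_mult_distrib add: power2_eq_square)
      finally have "2 ^ n * \<bar>v n x - v (Suc n) x\<bar> \<le> sqrt K"
        using K(2)[of n] by (intro real_le_rsqrt) simp
      then show "norm (v (Suc n) x - v n x) \<le> sqrt K * (1/2) ^ n"
        by (simp add: field_simps abs_minus_commute)
    qed
    then have "convergent (\<lambda>n. v n x)"
      unfolding summable_iff_convergent sum_lessThan_telescope[of "\<lambda>n. v n x"]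
      by (simp only: convergent_diff_const_right_iff)
    then show "(\<lambda>n. v n x) \<longlonglongrightarrow> lim (\<lambda>n. v n x)"
      by (simp add: convergent_LIMSEQ_iff)
  qed
  \<comment> \<open>\<open>lim\<close> is total, so \<open>p\<close> is defined, and measurable, off the set of convergence too\<close>
  define p where "p x = lim (\<lambda>n. v n x)" for x
  have [measurable]: "p \<in> borel_measurable P"
    unfolding p_def by measurable
  have le: "(\<integral>\<^sup>+x. ennreal ((v n x - p x)\<^sup>2) \<partial>P) \<le> ennreal (C * (1/8) ^ n)" for n
  proof -
    have "(\<integral>\<^sup>+x. ennreal ((v n x - p x)\<^sup>2) \<partial>P)
        = (\<integral>\<^sup>+x. liminf (\<lambda>m. ennreal ((v n x - v m x)\<^sup>2)) \<partial>P)"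
    proof (rule nn_integral_cong_AE, use conv in eventually_elim)
      fix x assume "(\<lambda>n. v n x) \<longlonglongrightarrow> lim (\<lambda>n. v n x)"
      then have "(\<lambda>m. ennreal ((v n x - v m x)\<^sup>2)) \<longlonglongrightarrow> ennreal ((v n x - p x)\<^sup>2)"
        unfolding p_def by (intro tendsto_intros)
      then show "ennreal ((v n x - p x)\<^sup>2) = liminf (\<lambda>m. ennreal ((v n x - v m x)\<^sup>2))"
        by (intro lim_imp_Liminf[symmetric]) auto
    qed
    also have "\<dots> \<le> liminf (\<lambda>m. \<integral>\<^sup>+x. ennreal ((v n x - v m x)\<^sup>2) \<partial>P)"
      by (rule nn_integral_liminf) measurable
    also have "\<dots> \<le> limsup (\<lambda>m. \<integral>\<^sup>+x. ennreal ((v n x - v m x)\<^sup>2) \<partial>P)"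
      by (intro Liminf_le_Limsup) simp
    also have "\<dots> \<le> ennreal (C * (1/8) ^ n)"
    proof (rule Limsup_bounded)
      show "\<forall>\<^sub>F m in sequentially.
          (\<integral>\<^sup>+x. ennreal ((v n x - v m x)\<^sup>2) \<partial>P) \<le> ennreal (C * (1/8) ^ n)"
        using eventually_ge_at_top[of n]
      proof eventually_elim
        fix m assume "n \<le> m"
        then show "(\<integral>\<^sup>+x. ennreal ((v n x - v m x)\<^sup>2) \<partial>P) \<le> ennreal (C * (1/8) ^ n)"
          using int C by (subst nn_integral_eq_integral) (auto intro!: ennreal_leI)
      qed
    qed
    finally show ?thesis .
  qed
  have int': "integrable P (\<lambda>x. (v n x - p x)\<^sup>2)" for n
    using le[of n] by (intro integrableI_nonneg) (auto simp: le_less_trans)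
  show ?thesis
  proof
    have "(\<lambda>x. v 0 x - p x) \<in> L2 P"
      using int' by (simp add: L2_def)
    from L2_diff[OF v[of 0] this] show "p \<in> L2 P"
      by simp
    show "(\<integral>x. (v n x - p x)\<^sup>2 \<partial>P) \<le> C * (1/8) ^ n" for n
      using le[of n] int' C0 by (simp add: nn_integral_eq_integral)
  qed
qed

text \<open>
  The projection onto the closure of a subspace.  By the parallelogram identity a minimising
  sequence for the distance to \<open>f\<close> is Cauchy, and its limit is the projection: near-minimality
  of a vector of the subspace makes its error nearly orthogonal to the subspace.
\<close>

lemma L2_projection:
  assumes f: "f \<in> L2 P" and V: "V \<subseteq> L2 P" "V \<noteq> {}"
    and lincomb: "\<And>u v a b. u \<in> V \<Longrightarrow> v \<in> V \<Longrightarrow> (\<lambda>x. a * u x + b * v x) \<in> V"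
  obtains p where "p \<in> L2 P"
    and "\<And>e. 0 < e \<Longrightarrow> \<exists>v\<in>V. (\<integral>x. (v x - p x)\<^sup>2 \<partial>P) < e"
    and "\<And>v. v \<in> V \<Longrightarrow> (\<integral>x. (f x - p x) * v x \<partial>P) = 0"
proof -
  define q where "q v = (\<integral>x. (f x - v x)\<^sup>2 \<partial>P)" for v
  define d where "d = Inf (q ` V)"
  have bdd: "bdd_below (q ` V)"
    by (rule bdd_belowI[of _ 0]) (auto simp: q_def)
  then have d_le: "d \<le> q v" if "v \<in> V" for v
    using that by (auto simp: d_def intro: cInf_lower)
  have "\<exists>v\<in>V. q v < d + (1/8) ^ n" for n :: nat
    using cInf_lessD[of "q ` V" "d + (1/8) ^ n"] V(2) by (auto simp flip: d_def)
  then obtain v where v: "\<And>n. v n \<in> V" "\<And>n. q (v n) < d + (1/8) ^ n"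
    by metis
  have vL: "v n \<in> L2 P" for n
    using v(1) V(1) by blast
  have fv: "(\<lambda>x. f x - v n x) \<in> L2 P" for n
    by (rule L2_diff[OF f vL])
  have Cauchy: "(\<integral>x. (v n x - v m x)\<^sup>2 \<partial>P) \<le> 4 * (1/8) ^ n" if "n \<le> m" for m n
  proof -
    \<comment> \<open>parallelogram identity: the midpoint lies in \<open>V\<close>, so its error is at least \<open>d\<close>\<close>
    let ?u = "\<lambda>x. 1/2 * v n x + 1/2 * v m x"
    let ?B = "\<integral>x. (f x - v n x) * (f x - v m x) \<partial>P"
    have "(\<integral>x. (v n x - v m x)\<^sup>2 \<partial>P) = q (v n) - 2 * ?B + q (v m)"
      using L2_lincomb_square_integral[OF fv fv, of "-1" n 1 m] by (simp add: q_def)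
    moreover have "q ?u = q (v n) / 4 + ?B / 2 + q (v m) / 4"
    proof -
      have "q ?u = (\<integral>x. (1/2 * (f x - v n x) + 1/2 * (f x - v m x))\<^sup>2 \<partial>P)"
        unfolding q_def
        by (rule Bochner_Integration.integral_cong) (auto simp: power2_eq_square field_simps)
      then show ?thesis
        unfolding L2_lincomb_square_integral[OF fv fv] by (simp add: q_def power2_eq_square)
    qed
    moreover have "d \<le> q ?u"
      by (intro d_le lincomb v)
    moreover have "(1/8 :: real) ^ m \<le> (1/8) ^ n"
      using that by (intro power_decreasing) auto
    ultimately show ?thesis
      using v(2)[of n] v(2)[of m] by linarith
  qed
  obtain p where p: "p \<in> L2 P" "\<And>n. (\<integral>x. (v n x - p x)\<^sup>2 \<partial>P) \<le> 4 * (1/8) ^ n"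
    using L2_geometrically_Cauchy_convergent[of v P 4, OF vL Cauchy] by blast
  have lim: "(\<lambda>n. c * (1/8) ^ n) \<longlonglongrightarrow> 0" for c :: real
    by (auto intro!: tendsto_mult_right_zero LIMSEQ_power_zero)
  show ?thesis
  proof
    show "p \<in> L2 P" by (rule p)
    fix e :: real assume "0 < e"
    then obtain n where "(1/8) ^ n < e / 4"
      using real_arch_pow_inv[of "e / 4" "1/8"] by auto
    then show "\<exists>v\<in>V. (\<integral>x. (v x - p x)\<^sup>2 \<partial>P) < e"
      using v(1)[of n] p(2)[of n] by (intro bexI[of _ "v n"]) auto
  next
    fix u assume u: "u \<in> V"
    then have uL: "u \<in> L2 P"
      using V(1) by blast
    have vp: "(\<lambda>x. v n x - p x) \<in> L2 P" for n
      by (rule L2_diff[OF vL p(1)])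
    let ?I = "\<integral>x. (f x - p x) * u x \<partial>P" and ?U = "\<integral>x. (u x)\<^sup>2 \<partial>P"
    have bound: "?I\<^sup>2 \<le> 10 * ?U * (1/8) ^ n" for n
    proof -
      let ?B = "\<integral>x. (f x - v n x) * u x \<partial>P" and ?E = "\<integral>x. (v n x - p x) * u x \<partial>P"
      \<comment> \<open>moving \<open>v n\<close> along \<open>u\<close> cannot push the error below \<open>d\<close>; the discriminant of this
        quadratic inequality bounds the inner product with \<open>u\<close>\<close>
      have "?B\<^sup>2 \<le> (q (v n) - d) * ?U"
      proof (rule nonneg_quadratic_discriminant)
        fix t :: real
        have "d \<le> q (\<lambda>x. 1 * v n x + (- t) * u x)"
          by (intro d_le lincomb v u)
        also have "\<dots> = (\<integral>x. (1 * (f x - v n x) + t * u x)\<^sup>2 \<partial>P)"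
          unfolding q_def by (rule Bochner_Integration.integral_cong) (auto simp: algebra_simps)
        also have "\<dots> = q (v n) + 2 * t * ?B + t\<^sup>2 * ?U"
          unfolding L2_lincomb_square_integral[OF fv uL] by (simp add: q_def)
        finally show "0 \<le> q (v n) - d + 2 * t * ?B + t\<^sup>2 * ?U"
          by simp
      qed simp
      also have "\<dots> \<le> (1/8) ^ n * ?U"
        using v(2)[of n] by (intro mult_right_mono) auto
      finally have B: "?B\<^sup>2 \<le> (1/8) ^ n * ?U" .
      have "?E\<^sup>2 \<le> (\<integral>x. (v n x - p x)\<^sup>2 \<partial>P) * ?U"
        by (rule L2_Cauchy_Schwarz[OF vp uL])
      also have "\<dots> \<le> 4 * (1/8) ^ n * ?U"
        using p(2)[of n] by (intro mult_right_mono) auto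
      finally have E: "?E\<^sup>2 \<le> 4 * (1/8) ^ n * ?U" .
      have "?I = (\<integral>x. (f x - v n x) * u x + (v n x - p x) * u x \<partial>P)"
        by (rule Bochner_Integration.integral_cong) (auto simp: algebra_simps)
      also have "\<dots> = ?B + ?E"
        using L2_product_integrable[OF fv uL] L2_product_integrable[OF vp uL] by simp
      finally have "?I\<^sup>2 \<le> 2 * ?B\<^sup>2 + 2 * ?E\<^sup>2"
        using sum_squares_bound[of ?B ?E] by (simp add: power2_sum)
      then show ?thesis
        using B E by (simp add: algebra_simps)
    qed
    have "?I\<^sup>2 \<le> 0"
      by (rule LIMSEQ_le_const[OF lim[of "10 * ?U"]]) (use bound in blast)
    then show "?I = 0"
      by simp
  qed
qed


section \<open>Measurability of the feature map\<close>

lemma inner_feature_map: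
  assumes "is_rkhs S k \<iota>" "x \<in> S" "y \<in> S"
  shows "inner (feature_map S k \<iota> x) (feature_map S k \<iota> y) = k x y"
  using feature_map(2)[OF assms(1,3), of "feature_map S k \<iota> x"] feature_map(1)[OF assms(1,2)] assms(3)
  by simp

text \<open>
  Choose points \<open>y\<close> whose features are dense among all features.  Expanding
  \<open>0 = inf \<parallel>\<phi> x - \<phi> y\<parallel>\<^sup>2\<close> over them gives \<open>\<parallel>\<phi> x\<parallel>\<^sup>2 = sup (2 k y x - k y y)\<close>, which is measurable
  in \<open>x\<close> because each section \<open>k y\<close> is.  Hence the distance from
  \<open>\<phi> x\<close> to each \<open>\<phi> y\<close> is measurable, and balls around the \<open>\<phi> y\<close> exhaust the open sets.
\<close>

lemma feature_map_measurable:
  fixes \<iota> :: "'h :: {real_inner, banach, second_countable_topology} \<Rightarrow> 'x \<Rightarrow> real"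
  assumes k: "\<And>x. x \<in> space N \<Longrightarrow> k x \<in> borel_measurable N"
    and rkhs: "is_rkhs (space N) k \<iota>"
  shows "feature_map (space N) k \<iota> \<in> borel_measurable N"
proof (cases "space N = {}")
  case True
  then show ?thesis
    by (simp add: measurable_def)
next
  case False
  define \<phi> where "\<phi> = feature_map (space N) k \<iota>"
  obtain D where D: "countable D" "D \<subseteq> \<phi> ` space N" "\<phi> ` space N \<subseteq> closure D"
    using separable by blast
  then obtain Y where Y: "countable Y" "Y \<subseteq> space N" "D = \<phi> ` Y"
    by (metis countable_subset_image)
  have "Y \<noteq> {}"
    using D False Y(3) by auto
  have near: "\<exists>y\<in>Y. dist (\<phi> x) (\<phi> y) < e" if "x \<in> space N" "0 < e" for x e
    using D(3) that Y(3) by (force simp: closure_approachable dist_commute)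
  have sq: "(norm (\<phi> x - \<phi> y))\<^sup>2 = (norm (\<phi> x))\<^sup>2 - (2 * k y x - k y y)"
    if "x \<in> space N" "y \<in> Y" for x y
  proof -
    have y: "y \<in> space N"
      using Y(2) that(2) by blast
    have "inner (\<phi> y) (\<phi> x) = k y x" "inner (\<phi> y) (\<phi> y) = k y y"
      unfolding \<phi>_def by (intro inner_feature_map[OF rkhs] y that)+
    then show ?thesis
      by (simp add: power2_norm_eq_inner inner_diff_left inner_diff_right inner_commute)
  qed
  have le: "2 * k y x - k y y \<le> (norm (\<phi> x))\<^sup>2" if "x \<in> space N" "y \<in> Y" for x y
    using sq[OF that] zero_le_power2[of "norm (\<phi> x - \<phi> y)"] by linarith
  have norm_eq: "(norm (\<phi> x))\<^sup>2 = (SUP y\<in>Y. 2 * k y x - k y y)" if x: "x \<in> space N" for x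
  proof (rule antisym)
    have bdd: "bdd_above ((\<lambda>y. 2 * k y x - k y y) ` Y)"
      using le[OF x] by (intro bdd_aboveI2)
    show "(norm (\<phi> x))\<^sup>2 \<le> (SUP y\<in>Y. 2 * k y x - k y y)"
    proof (rule field_le_epsilon)
      fix e :: real assume "0 < e"
      then obtain y where y: "y \<in> Y" "dist (\<phi> x) (\<phi> y) < sqrt e"
        using near[OF x, of "sqrt e"] by auto
      then have "(norm (\<phi> x - \<phi> y))\<^sup>2 < e"
        using power_strict_mono[of "norm (\<phi> x - \<phi> y)" "sqrt e" 2] \<open>0 < e\<close>
        by (simp add: dist_norm)
      moreover have "2 * k y x - k y y \<le> (SUP y\<in>Y. 2 * k y x - k y y)"
        by (rule cSUP_upper[OF y(1) bdd])
      ultimately show "(norm (\<phi> x))\<^sup>2 \<le> (SUP y\<in>Y. 2 * k y x - k y y) + e"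
        using sq[OF x y(1)] by linarith
    qed
    show "(SUP y\<in>Y. 2 * k y x - k y y) \<le> (norm (\<phi> x))\<^sup>2"
      using \<open>Y \<noteq> {}\<close> le[OF x] by (intro cSUP_least)
  qed
  have kY: "k y \<in> borel_measurable N" if "y \<in> Y" for y
    using k Y(2) that by blast
  have "(\<lambda>x. SUP y\<in>Y. 2 * k y x - k y y) \<in> borel_measurable N"
  proof (rule borel_measurable_cSUP)
    show "(\<lambda>x. 2 * k y x - k y y) \<in> borel_measurable N" if "y \<in> Y" for y
      using kY[OF that] by measurable
    show "bdd_above ((\<lambda>y. 2 * k y x - k y y) ` Y)" if "x \<in> space N" for x
      using le[OF that] by (intro bdd_aboveI2)
  qed (rule Y(1))
  then have norm_meas: "(\<lambda>x. (norm (\<phi> x))\<^sup>2) \<in> borel_measurable N"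
    by (subst measurable_cong[OF norm_eq])
  have dist_meas: "(\<lambda>x. dist (\<phi> x) (\<phi> y)) \<in> borel_measurable N" if y: "y \<in> Y" for y
  proof -
    have "(\<lambda>x. sqrt ((norm (\<phi> x))\<^sup>2 - (2 * k y x - k y y))) \<in> borel_measurable N"
      using kY[OF y] norm_meas by measurable
    moreover have "dist (\<phi> x) (\<phi> y) = sqrt ((norm (\<phi> x))\<^sup>2 - (2 * k y x - k y y))"
      if "x \<in> space N" for x
      using sq[OF that y] by (simp add: dist_norm flip: sq[OF that y])
    ultimately show ?thesis
      by (subst measurable_cong)
  qed
  have "\<phi> \<in> borel_measurable N"
  proof (rule borel_measurableI)
    fix U :: "'h set" assume U: "open U"
    have "\<phi> -` U \<inter> space N = (\<Union>y\<in>Y. \<Union>n\<in>{n. ball (\<phi> y) (1 / Suc n) \<subseteq> U}.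
        {x \<in> space N. dist (\<phi> x) (\<phi> y) < 1 / Suc n})" (is "_ = ?R")
    proof
      show "?R \<subseteq> \<phi> -` U \<inter> space N"
        by (auto simp: dist_commute subset_eq)
      show "\<phi> -` U \<inter> space N \<subseteq> ?R"
      proof
        fix x assume x: "x \<in> \<phi> -` U \<inter> space N"
        then obtain e where e: "0 < e" "ball (\<phi> x) e \<subseteq> U"
          using U by (auto elim: openE)
        obtain n where n: "1 / Suc n < e / 2"
          using reals_Archimedean[of "e / 2"] e(1) by (auto simp: inverse_eq_divide)
        obtain y where y: "y \<in> Y" "dist (\<phi> x) (\<phi> y) < 1 / Suc n"
          using near[of x "1 / Suc n"] x by auto
        have "ball (\<phi> y) (1 / Suc n) \<subseteq> ball (\<phi> x) e"
        proof
          fix z assume "z \<in> ball (\<phi> y) (1 / Suc n)"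
          then show "z \<in> ball (\<phi> x) e"
            using dist_triangle[of "\<phi> x" z "\<phi> y"] y(2) n by (simp del: of_nat_Suc)
        qed
        then show "x \<in> ?R"
          using e(2) x y by blast
      qed
    qed
    moreover have "?R \<in> sets N"
      using Y(1) dist_meas by (intro sets.countable_UN' countableI_type) auto
    ultimately show "\<phi> -` U \<inter> space N \<in> sets N"
      by simp
  qed
  then show ?thesis
    by (simp add: \<phi>_def)
qed


section \<open>Functions annihilated by the kernel space\<close>

text \<open>
  The positive and negative part of \<open>r\<close> have equal mass.  Unless this mass is zero, they are up
  to a common factor the densities of two probability measures.  Orthogonality to \<open>\<H>\<close> gives these
  the same mean embedding, hence they coincide, and \<open>r\<close> vanishes.
\<close>

lemma characteristic_kernel_annihilator:
  fixes \<iota> :: "'h :: {real_inner, banach, second_countable_topology} \<Rightarrow> 'x \<Rightarrow> real"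
  assumes char: "characteristic_kernel N k \<iota>" and rkhs: "is_rkhs (space N) k \<iota>"
    and P: "prob_space P" "sets P = sets N"
    and meas: "feature_map (space N) k \<iota> \<in> borel_measurable N"
    and r: "integrable P r" "(\<integral>x. r x \<partial>P) = 0"
    and r\<phi>: "integrable P (\<lambda>x. r x *\<^sub>R feature_map (space N) k \<iota> x)"
    and orth: "\<And>h. (\<integral>x. r x * \<iota> h x \<partial>P) = 0"
  shows "AE x in P. r x = 0"
proof -
  interpret P: prob_space P by (rule P)
  define \<phi> where "\<phi> = feature_map (space N) k \<iota>"
  have sp: "space P = space N"
    using P(2) by (rule sets_eq_imp_space_eq)
  have [measurable]: "\<phi> \<in> borel_measurable P" "r \<in> borel_measurable P"
    using meas P(2) r(1) by (auto simp: \<phi>_def cong: measurable_cong_sets)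
  note r\<phi> = r\<phi>[folded \<phi>_def]
  have r\<phi>0: "(\<integral>x. r x *\<^sub>R \<phi> x \<partial>P) = 0"
  proof -
    have "inner h (\<integral>x. r x *\<^sub>R \<phi> x \<partial>P) = (\<integral>x. r x * \<iota> h x \<partial>P)" for h
    proof -
      have "inner h (\<integral>x. r x *\<^sub>R \<phi> x \<partial>P) = (\<integral>x. inner h (r x *\<^sub>R \<phi> x) \<partial>P)"
        using r\<phi> by (intro integral_inner_right[symmetric])
      also have "\<dots> = (\<integral>x. r x * \<iota> h x \<partial>P)"
        by (rule Bochner_Integration.integral_cong)
          (auto simp: \<phi>_def sp feature_map(2)[OF rkhs, of _ h])
      finally show ?thesis .
    qed
    then show ?thesis
      using orth by (metis inner_eq_zero_iff)
  qed
  define c where "c = (\<integral>x. max 0 (r x) \<partial>P)"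
  \<comment> \<open>the sign \<open>s\<close> selects the positive part (\<open>s = 1\<close>) or the negative part (\<open>s = -1\<close>) of \<open>r\<close>\<close>
  define Q where "Q s = density P (\<lambda>x. ennreal (max 0 (s * r x) / c))" for s :: real
  have ip: "integrable P (\<lambda>x. max 0 (s * r x))" for s
    using r(1) by auto
  have c': "(\<integral>x. max 0 (s * r x) \<partial>P) = c" if "s \<in> {1, -1}" for s
  proof -
    have "(\<integral>x. max 0 (r x) - max 0 (- 1 * r x) \<partial>P) = (\<integral>x. r x \<partial>P)"
      by (rule Bochner_Integration.integral_cong) auto
    then show ?thesis
      using that ip[of "-1"] ip[of 1] r(2) by (auto simp: c_def)
  qed
  have "0 \<le> c"
    by (auto simp: c_def)
  show ?thesis
  proof (cases "c = 0")
    case True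
    have "AE x in P. max 0 (s * r x) = 0" if "s \<in> {1, -1}" for s
      using c'[OF that] True ip[of s] by (simp add: integral_nonneg_eq_0_iff_AE)
    from this[of 1] this[of "-1"] show ?thesis
      by (auto elim!: eventually_elim2)
  next
    case False
    then have c: "0 < c"
      using \<open>0 \<le> c\<close> by simp
    have Q: "prob_space (Q s) \<and> sets (Q s) = sets N \<and> integrable (Q s) (\<lambda>x. norm (\<phi> x))"
      if s: "s \<in> {1, -1}" for s
    proof (intro conjI)
      have "emeasure (Q s) (space (Q s)) = (\<integral>\<^sup>+x. ennreal (max 0 (s * r x) / c) \<partial>P)"
        unfolding Q_def by (simp add: emeasure_density cong: nn_integral_cong)
      also have "\<dots> = ennreal (\<integral>x. max 0 (s * r x) / c \<partial>P)"
        using ip c by (intro nn_integral_eq_integral) auto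
      finally show "prob_space (Q s)"
        using c' s c by (intro prob_spaceI) auto
      show "sets (Q s) = sets N"
        by (simp add: Q_def P(2))
      have "integrable P (\<lambda>x. (max 0 (s * r x) / c) *\<^sub>R norm (\<phi> x))"
      proof (rule Bochner_Integration.integrable_bound)
        show "integrable P (\<lambda>x. norm (r x *\<^sub>R \<phi> x) / c)"
          by (intro integrable_divide integrable_norm r\<phi>)
        show "AE x in P. norm ((max 0 (s * r x) / c) *\<^sub>R norm (\<phi> x))
            \<le> norm (norm (r x *\<^sub>R \<phi> x) / c)"
          using c s by (intro AE_I2) (auto simp: abs_mult max_def intro!: divide_right_mono)
      qed measurable
      then show "integrable (Q s) (\<lambda>x. norm (\<phi> x))"
        unfolding Q_def using c by (subst integrable_density) auto
    qed
    have emb: "integral\<^sup>L (Q s) \<phi> = (\<integral>x. (max 0 (s * r x) / c) *\<^sub>R \<phi> x \<partial>P)"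
      and emb_int: "integrable P (\<lambda>x. (max 0 (s * r x) / c) *\<^sub>R \<phi> x)"
      if "s \<in> {1, -1}" for s
    proof -
      show "integral\<^sup>L (Q s) \<phi> = (\<integral>x. (max 0 (s * r x) / c) *\<^sub>R \<phi> x \<partial>P)"
        unfolding Q_def using c by (subst integral_density) auto
      have "\<phi> \<in> borel_measurable (Q s)"
        by (simp add: Q_def)
      then have "integrable (Q s) \<phi>"
        using Q[OF that] integrable_norm_iff by blast
      then show "integrable P (\<lambda>x. (max 0 (s * r x) / c) *\<^sub>R \<phi> x)"
        unfolding Q_def using c by (subst (asm) integrable_density) auto
    qed
    have "integral\<^sup>L (Q 1) \<phi> - integral\<^sup>L (Q (-1)) \<phi>
        = (\<integral>x. (max 0 (1 * r x) / c) *\<^sub>R \<phi> x - (max 0 (-1 * r x) / c) *\<^sub>R \<phi> x \<partial>P)"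
      using emb_int[of 1] emb_int[of "-1"] emb[of 1] emb[of "-1"] by simp
    also have "\<dots> = (\<integral>x. (1 / c) *\<^sub>R (r x *\<^sub>R \<phi> x) \<partial>P)"
      by (rule Bochner_Integration.integral_cong) (auto simp: max_def simp flip: scaleR_diff_left)
    also have "\<dots> = 0"
      unfolding integral_scaleR_right using r\<phi>0 by simp
    finally have "integral\<^sup>L (Q 1) \<phi> = integral\<^sup>L (Q (-1)) \<phi>"
      by simp
    then have "Q 1 = Q (-1)"
      using char Q[of 1] Q[of "-1"]
      unfolding characteristic_kernel_def \<phi>_def[symmetric] inj_on_def by auto
    then have "AE x in P. ennreal (max 0 (1 * r x) / c) = ennreal (max 0 (-1 * r x) / c)"
      unfolding Q_def by (subst (asm) P.density_unique_iff) auto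
    then show ?thesis
    proof eventually_elim
      fix x assume "ennreal (max 0 (1 * r x) / c) = ennreal (max 0 (-1 * r x) / c)"
      then have "max 0 (r x) = max 0 (- r x)"
        using c by (subst (asm) ennreal_inj) auto
      then show "r x = 0"
        by (auto simp: max_def split: if_splits)
    qed
  qed
qed


section \<open>Density\<close>

theorem lemmaA4:
  fixes M :: "'w measure" and N :: "'x measure" and X :: "'w \<Rightarrow> 'x"
    and k :: "'x \<Rightarrow> 'x \<Rightarrow> real"
    and \<iota> :: "'h :: {real_inner, banach, second_countable_topology} \<Rightarrow> 'x \<Rightarrow> real"
  assumes "prob_space M"
    and "pos_def_kernel (space N) k"
    and "\<forall>x\<in>space N. k x \<in> borel_measurable N"
    and "is_rkhs (space N) k \<iota>"
    and "X \<in> measurable M N"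
    and "integrable M (\<lambda>w. (norm (feature_map (space N) k \<iota> (X w)))\<^sup>2)"
    and "\<forall>h. (AE x in distr M N X. \<iota> h x = 0) \<longleftrightarrow> h = 0"
    and "characteristic_kernel N k \<iota>"
  shows "HC (distr M N X) \<iota> \<subseteq> L2C (distr M N X) \<and>
    L2C_topology M N X closure_of HC (distr M N X) \<iota> = L2C (distr M N X)"
proof -
  interpret M: prob_space M by fact
  note X [measurable] = \<open>X \<in> measurable M N\<close>
  note rkhs = \<open>is_rkhs (space N) k \<iota>\<close>
  define P where "P = distr M N X"
  define \<phi> where "\<phi> = feature_map (space N) k \<iota>"
  interpret P: prob_space P
    unfolding P_def by (rule M.prob_space_distr) measurable
  have sets_P [simp]: "sets P = sets N" and space_P: "space P = space N"
    by (auto simp: P_def)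
  have \<phi>N: "\<phi> \<in> borel_measurable N"
    unfolding \<phi>_def using assms(3,4) by (intro feature_map_measurable) auto
  then have \<phi>P [measurable]: "\<phi> \<in> borel_measurable P"
    by (simp cong: measurable_cong_sets)
  have \<phi>sq: "integrable P (\<lambda>x. (norm (\<phi> x))\<^sup>2)"
    unfolding P_def using assms(6) \<phi>N by (subst integrable_distr_eq) (auto simp: \<phi>_def)
  have \<iota>: "\<iota> h x = inner h (\<phi> x)" if "x \<in> space P" for h x
    using feature_map(2)[OF rkhs] that by (simp add: \<phi>_def space_P)
  have \<iota>L: "\<iota> h \<in> L2 P" for h
  proof -
    have "(\<lambda>x. inner h (\<phi> x)) \<in> borel_measurable P"
      by measurable
    then have m [measurable]: "\<iota> h \<in> borel_measurable P"
      by (subst measurable_cong[OF \<iota>])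
    have "integrable P (\<lambda>x. (\<iota> h x)\<^sup>2)"
    proof (rule Bochner_Integration.integrable_bound)
      show "integrable P (\<lambda>x. (norm h)\<^sup>2 * (norm (\<phi> x))\<^sup>2)"
        using \<phi>sq by simp
      have "(inner h y)\<^sup>2 \<le> (norm h)\<^sup>2 * (norm y)\<^sup>2" for y
        using Cauchy_Schwarz_ineq[of h y] by (simp add: power2_norm_eq_inner)
      then show "AE x in P. norm ((\<iota> h x)\<^sup>2) \<le> norm ((norm h)\<^sup>2 * (norm (\<phi> x))\<^sup>2)"
        by (intro AE_I2) (simp add: \<iota>)
    qed measurable
    then show ?thesis
      by (simp add: L2_def)
  qed
  have constL: "(\<lambda>x. c) \<in> L2 P" for c
    by (simp add: L2_def)
  have HC_sub: "HC P \<iota> \<subseteq> L2C P"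
    using \<iota>L by (auto simp: HC_def intro: L2C_class_in)
  have approx: "\<exists>h. L2C_dist M N X F (L2C_class P (\<iota> h)) < \<epsilon>" if F: "F \<in> L2C P" and \<epsilon>: "0 < \<epsilon>" for F \<epsilon>
  proof -
    define f where "f = L2C_rep F"
    have f: "f \<in> L2 P" "L2C_class P f = F"
      using L2C_rep[OF F] by (auto simp: f_def)
    \<comment> \<open>values off \<open>space P\<close> are left free: there \<open>\<iota>\<close> need not be linear, so \<open>V\<close> would not be a subspace\<close>
    define V where "V = {v. \<exists>h c. \<forall>x\<in>space P. v x = \<iota> h x + c}"
    have VI: "(\<lambda>x. \<iota> h x + c) \<in> V" for h c
      by (auto simp: V_def)
    have V_sub: "V \<subseteq> L2 P"
    proof
      fix v assume "v \<in> V"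
      then obtain h c where v: "\<And>x. x \<in> space P \<Longrightarrow> v x = \<iota> h x + c"
        by (auto simp: V_def)
      have "(\<lambda>x. 1 * \<iota> h x + 1 * c) \<in> L2 P"
        by (rule L2_lincomb[OF \<iota>L constL])
      then show "v \<in> L2 P"
        by (simp add: L2_def v cong: measurable_cong Bochner_Integration.integrable_cong)
    qed
    have lincomb: "(\<lambda>x. a * u x + b * v x) \<in> V" if uv: "u \<in> V" "v \<in> V" for u v a b
    proof -
      from uv obtain g c h d where
        "\<forall>x\<in>space P. u x = \<iota> g x + c" "\<forall>x\<in>space P. v x = \<iota> h x + d"
        by (auto simp: V_def)
      then have "\<forall>x\<in>space P. a * u x + b * v x
          = \<iota> (a *\<^sub>R g + b *\<^sub>R h) x + (a * c + b * d)"
        by (simp add: \<iota> inner_add_left algebra_simps)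
      then show ?thesis
        unfolding V_def by blast
    qed
    obtain p where p: "p \<in> L2 P" "\<And>e. 0 < e \<Longrightarrow> \<exists>v\<in>V. (\<integral>x. (v x - p x)\<^sup>2 \<partial>P) < e"
        "\<And>v. v \<in> V \<Longrightarrow> (\<integral>x. (f x - p x) * v x \<partial>P) = 0"
      using L2_projection[OF f(1) V_sub _ lincomb] VI by blast
    define r where "r x = f x - p x" for x
    have r: "r \<in> L2 P"
      unfolding r_def by (rule L2_diff[OF f(1) p(1)])
    have r0: "AE x in P. r x = 0"
    proof (rule characteristic_kernel_annihilator[OF assms(8) rkhs P.prob_space_axioms sets_P])
      show "feature_map (space N) k \<iota> \<in> borel_measurable N"
        using \<phi>N by (simp add: \<phi>_def)
      show "integrable P r"
        using L2_product_integrable[OF r constL[of 1]] by simp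
      have i0: "\<iota> 0 x = 0" if "x \<in> space P" for x
        using \<iota>[OF that] by simp
      have "(\<integral>x. r x \<partial>P) = (\<integral>x. (f x - p x) * (\<iota> 0 x + 1) \<partial>P)"
        by (rule Bochner_Integration.integral_cong) (auto simp: r_def i0)
      then show "(\<integral>x. r x \<partial>P) = 0"
        using p(3)[OF VI] by simp
      show "(\<integral>x. r x * \<iota> h x \<partial>P) = 0" for h
        using p(3)[OF VI[of h 0]] by (simp add: r_def)
      have "(\<lambda>x. norm (\<phi> x)) \<in> L2 P"
        using \<phi>sq by (simp add: L2_def)
      from L2_product_integrable[OF r this]
      show "integrable P (\<lambda>x. r x *\<^sub>R feature_map (space N) k \<iota> x)"
      proof (rule Bochner_Integration.integrable_bound)
        have "r \<in> borel_measurable P"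
          using r by (simp add: L2_def)
        then show "(\<lambda>x. r x *\<^sub>R feature_map (space N) k \<iota> x) \<in> borel_measurable P"
          unfolding \<phi>_def[symmetric] by measurable
      qed (simp add: \<phi>_def)
    qed
    obtain v where v: "v \<in> V" "(\<integral>x. (v x - p x)\<^sup>2 \<partial>P) < \<epsilon>\<^sup>2"
      using p(2)[of "\<epsilon>\<^sup>2"] \<epsilon> by auto
    then obtain h c where h: "\<And>x. x \<in> space P \<Longrightarrow> v x = \<iota> h x + c"
      by (auto simp: V_def)
    define g where "g x = f x - \<iota> h x" for x
    have g: "g \<in> L2 P"
      unfolding g_def by (rule L2_diff[OF f(1) \<iota>L])
    have gc: "(\<lambda>x. g x - c) \<in> L2 P"
      by (rule L2_diff[OF g constL])
    \<comment> \<open>among constants, the mean has the least mean squared distance\<close>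
    have "covariance M (\<lambda>w. g (X w)) (\<lambda>w. g (X w)) \<le> (\<integral>x. (g x - c)\<^sup>2 \<partial>P)"
    proof -
      have [measurable]: "g \<in> borel_measurable N"
        using g by (simp add: L2_def cong: measurable_cong_sets)
      have "covariance M (\<lambda>w. g (X w)) (\<lambda>w. g (X w)) = (\<integral>x. (g x)\<^sup>2 \<partial>P) - (\<integral>x. g x \<partial>P)\<^sup>2"
        using Cov_eq[OF M.prob_space_axioms X, of g g] g
        by (simp add: P_def integral_distr power2_eq_square)
      also have "\<dots> \<le> (\<integral>x. (1 * g x + (- c) * 1)\<^sup>2 \<partial>P)"
        unfolding L2_lincomb_square_integral[OF g constL]
        using zero_le_power2[of "(\<integral>x. g x \<partial>P) - c"]
        by (simp add: P.prob_space power2_diff algebra_simps)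
      finally show ?thesis
        by simp
    qed
    also have "\<dots> = (\<integral>x. (v x - p x)\<^sup>2 \<partial>P)"
    proof (rule integral_cong_AE)
      show "AE x in P. (g x - c)\<^sup>2 = (v x - p x)\<^sup>2"
        using r0 AE_space
        by eventually_elim (simp add: r_def g_def h power2_eq_square algebra_simps)
    qed (use gc L2_diff[OF subsetD[OF V_sub v(1)] p(1)] in \<open>auto simp: L2_def\<close>)
    finally have "covariance M (\<lambda>w. g (X w)) (\<lambda>w. g (X w)) < \<epsilon>\<^sup>2"
      using v(2) by simp
    then have "sqrt (covariance M (\<lambda>w. g (X w)) (\<lambda>w. g (X w))) < \<epsilon>"
      using \<epsilon> real_sqrt_less_iff[of _ "\<epsilon>\<^sup>2"] by simp
    moreover have "L2C_dist M N X F (L2C_class P (\<iota> h))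
        = sqrt (covariance M (\<lambda>w. g (X w)) (\<lambda>w. g (X w)))"
      using L2C_dist_class[OF M.prob_space_axioms X, of f "\<iota> h"] f \<iota>L
      by (simp add: g_def P_def)
    ultimately show ?thesis
      by (intro exI[of _ h]) simp
  qed
  interpret Metric_space "L2C P" "L2C_dist M N X"
    unfolding P_def by (rule Metric_space_L2C[OF M.prob_space_axioms X])
  have "L2C_topology M N X closure_of HC P \<iota> = L2C P"
  proof -
    have "\<exists>G\<in>HC P \<iota>. G \<in> mball F e" if "F \<in> L2C P" "0 < e" for F e
      using approx[OF that] that(1) HC_sub by (auto simp: HC_def)
    then show ?thesis
      unfolding L2C_topology_def P_def[symmetric] metric_closure_of by auto
  qed
  then show ?thesis
    using HC_sub by (simp add: P_def)
qed

end
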